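(* Let $m,q\geq 2$ and let $C$ be a code in $H(m,q)$ that is $X$-neighbour transitive for some group $X\leq\mathrm{Diag}_m(S_q)\rtimes L$. Then one of the following holds: (i) $C=\{(a,\ldots,a)\}$ for some $a\in Q$; (ii) $C=\mathrm{Rep}(m,q)$; (iii) $C=\mathrm{Inj}(m,q)$ where $m<q$; (iv) $C=W([m/2],2)$ where $q=2$ and $m\geq 3$ is odd; (v) there exists a positive integer $p$ such that $m=pq$ and $C\subseteq\mathrm{All}(pq,q)$.
   Context: $H(m,q)$ is the Hamming graph on $Q^m$, $|Q|=q$, adjacency = differing in exactly one entry. Its automorphism group is $B\rtimes L$ with $B\cong S_q^m$ acting entrywise ($\alpha^{(g_1,\ldots,g_m)}=(\alpha_1^{g_1},\ldots,\alpha_m^{g_m})$) and $L\cong S_m$ permuting entries ($\alpha^\sigma=(\alpha_{1\sigma^{-1}},\ldots,\alpha_{m\sigma^{-1}})$); $\mathrm{Diag}_m(S_q)=\{(h,\ldots,h):h\in S_q\}$. For a code $C$ (subset of vertices), $C_1$ is the set of non-codewords adjacent to some codeword; $C$ is $X$-neighbour transitive if $C$ and $C_1$ are $X$-orbits. $\mathrm{Rep}(m,q)=\{(a,\ldots,a):a\in Q\}$; $\mathrm{Inj}(m,q)$ is the set of vertices with pairwise distinct entries; for $Q=\{0,1\}$, $W([m/2],2)$ is the set of vertices with exactly $(m-1)/2$ or $(m+1)/2$ entries equal to $1$; $\mathrm{All}(pq,q)$ is the set of vertices of $H(pq,q)$ in which every letter of $Q$ occurs exactly $p$ times. *)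

theory Defs
  imports "HOL-Algebra.Group_Action" "HOL-Combinatorics.Permutations" "HOL-Library.FuncSet"
begin

text \<open>
  The vertices of \<open>H(m,q)\<close> are the words \<open>\<alpha> = (\<alpha> 1, ..., \<alpha> m)\<close> over an alphabet \<open>Q\<close> with
  \<open>card Q = q\<close>, as extensional functions on \<open>{1..m}\<close>.
\<close>

definition ham_vertices :: "nat \<Rightarrow> 'a set \<Rightarrow> (nat \<Rightarrow> 'a) set" where
  "ham_vertices m Q = ({1..m} \<rightarrow>\<^sub>E Q)"

definition ham_adj :: "nat \<Rightarrow> (nat \<Rightarrow> 'a) \<Rightarrow> (nat \<Rightarrow> 'a) \<Rightarrow> bool" where
  "ham_adj m \<alpha> \<beta> \<longleftrightarrow> card {i \<in> {1..m}. \<alpha> i \<noteq> \<beta> i} = 1"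

text \<open>
  Automorphisms are elements of \<^term>\<open>BijGroup (ham_vertices m Q)\<close>. Its multiplication composes
  maps from right to left, whereas the exponent notation \<open>\<alpha>\<^sup>g\<close> denotes a right action; a set of
  bijections is a subgroup for one order of composition iff it is for the other, and orbits do not
  depend on the order either.
\<close>

definition entrywise :: "nat \<Rightarrow> 'a set \<Rightarrow> (nat \<Rightarrow> 'a \<Rightarrow> 'a) \<Rightarrow> (nat \<Rightarrow> 'a) \<Rightarrow> (nat \<Rightarrow> 'a)" where
  "entrywise m Q g = (\<lambda>\<alpha> \<in> ham_vertices m Q. \<lambda>i \<in> {1..m}. g i (\<alpha> i))"

definition permute_entries :: "nat \<Rightarrow> 'a set \<Rightarrow> (nat \<Rightarrow> nat) \<Rightarrow> (nat \<Rightarrow> 'a) \<Rightarrow> (nat \<Rightarrow> 'a)" where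
  "permute_entries m Q \<sigma> = (\<lambda>\<alpha> \<in> ham_vertices m Q. \<lambda>i \<in> {1..m}. \<alpha> (Hilbert_Choice.inv \<sigma> i))"

definition diag_group :: "nat \<Rightarrow> 'a set \<Rightarrow> ((nat \<Rightarrow> 'a) \<Rightarrow> (nat \<Rightarrow> 'a)) set" where
  "diag_group m Q = {entrywise m Q (\<lambda>i. h) | h. h permutes Q}"

definition top_group :: "nat \<Rightarrow> 'a set \<Rightarrow> ((nat \<Rightarrow> 'a) \<Rightarrow> (nat \<Rightarrow> 'a)) set" where
  "top_group m Q = {permute_entries m Q \<sigma> | \<sigma>. \<sigma> permutes {1..m}}"

text \<open>
  \<open>Diag\<^sub>m(S\<^sub>q) \<rtimes> L\<close> is an internal semidirect product, so as a set it is the product of the two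
  subgroups \<open>Diag\<^sub>m(S\<^sub>q)\<close> and \<open>L\<close>.
\<close>

definition diag_top_group :: "nat \<Rightarrow> 'a set \<Rightarrow> ((nat \<Rightarrow> 'a) \<Rightarrow> (nat \<Rightarrow> 'a)) set" where
  "diag_top_group m Q =
     diag_group m Q <#>\<^bsub>BijGroup (ham_vertices m Q)\<^esub> top_group m Q"

definition neighbour_set :: "nat \<Rightarrow> 'a set \<Rightarrow> (nat \<Rightarrow> 'a) set \<Rightarrow> (nat \<Rightarrow> 'a) set" where
  "neighbour_set m Q C = {\<beta> \<in> ham_vertices m Q - C. \<exists>\<alpha> \<in> C. ham_adj m \<alpha> \<beta>}"

definition neighbour_transitive ::
    "nat \<Rightarrow> 'a set \<Rightarrow> ((nat \<Rightarrow> 'a) \<Rightarrow> (nat \<Rightarrow> 'a)) set \<Rightarrow> (nat \<Rightarrow> 'a) set \<Rightarrow> bool" where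
  "neighbour_transitive m Q X C \<longleftrightarrow>
     (let V = ham_vertices m Q;
          X_orbits = orbits (BijGroup V\<lparr>carrier := X\<rparr>) V (\<lambda>x. x)
      in C \<in> X_orbits \<and> neighbour_set m Q C \<in> X_orbits)"

definition const_word :: "nat \<Rightarrow> 'a \<Rightarrow> nat \<Rightarrow> 'a" where
  "const_word m a = (\<lambda>i \<in> {1..m}. a)"

definition Rep :: "nat \<Rightarrow> 'a set \<Rightarrow> (nat \<Rightarrow> 'a) set" where
  "Rep m Q = {const_word m a | a. a \<in> Q}"

definition Inj :: "nat \<Rightarrow> 'a set \<Rightarrow> (nat \<Rightarrow> 'a) set" where
  "Inj m Q = {\<alpha> \<in> ham_vertices m Q. inj_on \<alpha> {1..m}}"

definition letter_count :: "nat \<Rightarrow> 'a \<Rightarrow> (nat \<Rightarrow> 'a) \<Rightarrow> nat" where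
  "letter_count m a \<alpha> = card {i \<in> {1..m}. \<alpha> i = a}"

text \<open>
  \<open>W([m/2],2)\<close>, where the letter \<open>b\<close> of the two-letter alphabet \<open>Q\<close> plays the role of \<open>1\<close>.
  It is only used for odd \<open>m\<close>, where both divisions are exact.
\<close>

definition W_half :: "nat \<Rightarrow> 'a set \<Rightarrow> 'a \<Rightarrow> (nat \<Rightarrow> 'a) set" where
  "W_half m Q b = {\<alpha> \<in> ham_vertices m Q.
     letter_count m b \<alpha> = (m - 1) div 2 \<or> letter_count m b \<alpha> = (m + 1) div 2}"

text \<open>The code \<open>All(pq,q)\<close> with \<open>q = card Q\<close>.\<close>

definition All_code :: "nat \<Rightarrow> 'a set \<Rightarrow> (nat \<Rightarrow> 'a) set" where
  "All_code p Q = {\<alpha> \<in> ham_vertices (p * card Q) Q.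
     \<forall>a \<in> Q. letter_count (p * card Q) a \<alpha> = p}"

end

theory Submission
  imports Defs
begin

text \<open>
  Give a word the weight \<open>\<Sum>a. n\<^sub>a\<^sup>2\<close>, where \<open>n\<^sub>a\<close> counts the occurrences of the letter \<open>a\<close>. The group
  \<open>Diag\<^sub>m(S\<^sub>q) \<rtimes> L\<close> preserves the weight, which is therefore constant on \<open>C\<close> and on \<open>C\<^sub>1\<close>.
  Replacing an entry \<open>a\<close> of a word by \<open>b\<close> changes the weight by \<open>2 (n\<^sub>b - n\<^sub>a + 1)\<close>, so for a codeword
  \<open>n\<^sub>b - n\<^sub>a + 1\<close> takes at most one value \<open>D \<noteq> 0\<close>, and it is \<open>0\<close> exactly when the new word is again in
  \<open>C\<close>. This leaves four possible shapes for the counts \<open>n\<^sub>a\<close>: all equal; a single letter; all at most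
  \<open>1\<close> with a letter missing; or two letters with counts \<open>k\<close> and \<open>k + 1\<close>. In the last two cases \<open>C\<close> is
  closed under all moves that preserve the shape, and these moves connect \<open>Inj\<close> and \<open>W\<close>.
\<close>

section \<open>Letter and entry permutations as explicit bijections of the vertices\<close>

lemma Bij_by_inverse:
  assumes "f \<in> extensional V" "\<And>x. x \<in> V \<Longrightarrow> f x \<in> V" "\<And>x. x \<in> V \<Longrightarrow> g x \<in> V"
    and "\<And>x. x \<in> V \<Longrightarrow> g (f x) = x" "\<And>x. x \<in> V \<Longrightarrow> f (g x) = x"
  shows "f \<in> Bij V"
proof -
  have "bij_betw f V V"
    by (rule bij_betw_byWitness[where f' = g]) (use assms in auto)
  then show ?thesis using assms(1) by (simp add: Bij_def)
qed

lemma ham_vertices_eqI: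
  assumes "\<alpha> \<in> ham_vertices m Q" "\<beta> \<in> ham_vertices m Q" "\<And>i. i \<in> {1..m} \<Longrightarrow> \<alpha> i = \<beta> i"
  shows "\<alpha> = \<beta>"
  using assms PiE_ext unfolding ham_vertices_def by blast

lemma ham_vertices_upd:
  "\<alpha> \<in> ham_vertices m Q \<Longrightarrow> i \<in> {1..m} \<Longrightarrow> b \<in> Q \<Longrightarrow> \<alpha>(i := b) \<in> ham_vertices m Q"
  by (auto simp: ham_vertices_def PiE_iff extensional_def)

lemma ham_adj_upd:
  assumes "i \<in> {1..m}" "b \<noteq> \<alpha> i"
  shows "ham_adj m \<alpha> (\<alpha>(i := b))"
proof -
  have "{j \<in> {1..m}. \<alpha> j \<noteq> (\<alpha>(i := b)) j} = {i}" using assms by auto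
  then show ?thesis by (simp add: ham_adj_def)
qed

lemma entrywise_apply:
  "x \<in> ham_vertices m Q \<Longrightarrow> i \<in> {1..m} \<Longrightarrow> entrywise m Q g x i = g i (x i)"
  by (simp add: entrywise_def)

lemma entrywise_closed:
  assumes "h permutes Q" "x \<in> ham_vertices m Q"
  shows "entrywise m Q (\<lambda>i. h) x \<in> ham_vertices m Q"
  using assms(2) permutes_in_image[OF assms(1)] by (auto simp: entrywise_def ham_vertices_def)

lemma entrywise_inverse:
  assumes "h permutes Q" "k permutes Q" "\<And>a. k (h a) = a" "x \<in> ham_vertices m Q"
  shows "entrywise m Q (\<lambda>i. k) (entrywise m Q (\<lambda>i. h) x) = x"
proof (rule ham_vertices_eqI)
  note closed = entrywise_closed[OF assms(1,4)]
  show "entrywise m Q (\<lambda>i. k) (entrywise m Q (\<lambda>i. h) x) \<in> ham_vertices m Q"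
    by (rule entrywise_closed[OF assms(2) closed])
  show "entrywise m Q (\<lambda>i. k) (entrywise m Q (\<lambda>i. h) x) i = x i" if "i \<in> {1..m}" for i
    by (simp only: entrywise_apply[OF closed that] entrywise_apply[OF assms(4) that] assms(3))
qed (rule assms(4))

lemma entrywise_Bij:
  assumes "h permutes Q"
  shows "entrywise m Q (\<lambda>i. h) \<in> Bij (ham_vertices m Q)"
proof (rule Bij_by_inverse)
  note inv = permutes_inv[OF assms]
  fix x assume x: "x \<in> ham_vertices m Q"
  show "entrywise m Q (\<lambda>i. h) x \<in> ham_vertices m Q"
    by (rule entrywise_closed[OF assms x])
  show "entrywise m Q (\<lambda>i. Hilbert_Choice.inv h) x \<in> ham_vertices m Q"
    by (rule entrywise_closed[OF inv x])
  show "entrywise m Q (\<lambda>i. Hilbert_Choice.inv h) (entrywise m Q (\<lambda>i. h) x) = x"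
    by (rule entrywise_inverse[OF assms inv permutes_inverses(2)[OF assms] x])
  show "entrywise m Q (\<lambda>i. h) (entrywise m Q (\<lambda>i. Hilbert_Choice.inv h) x) = x"
    by (rule entrywise_inverse[OF inv assms permutes_inverses(1)[OF assms] x])
qed (simp add: entrywise_def)

lemma permute_entries_apply:
  "x \<in> ham_vertices m Q \<Longrightarrow> i \<in> {1..m} \<Longrightarrow>
    permute_entries m Q \<sigma> x i = x (Hilbert_Choice.inv \<sigma> i)"
  by (simp add: permute_entries_def)

lemma permute_entries_closed:
  assumes "\<sigma> permutes {1..m}" "x \<in> ham_vertices m Q"
  shows "permute_entries m Q \<sigma> x \<in> ham_vertices m Q"
  using assms(2) permutes_in_image[OF permutes_inv[OF assms(1)]]
  by (auto simp: permute_entries_def ham_vertices_def)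

lemma permute_entries_inverse:
  assumes "\<sigma> permutes {1..m}" "x \<in> ham_vertices m Q"
  shows "permute_entries m Q (Hilbert_Choice.inv \<sigma>) (permute_entries m Q \<sigma> x) = x"
proof (rule ham_vertices_eqI)
  note closed = permute_entries_closed[OF assms]
  show "permute_entries m Q (Hilbert_Choice.inv \<sigma>) (permute_entries m Q \<sigma> x) \<in> ham_vertices m Q"
    by (rule permute_entries_closed[OF permutes_inv[OF assms(1)] closed])
  fix i assume i: "i \<in> {1..m}"
  have \<sigma>i: "\<sigma> i \<in> {1..m}" using i permutes_in_image[OF assms(1)] by blast
  show "permute_entries m Q (Hilbert_Choice.inv \<sigma>) (permute_entries m Q \<sigma> x) i = x i"
    by (simp only: permute_entries_apply[OF closed i] permutes_inv_inv[OF assms(1)]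
        permute_entries_apply[OF assms(2) \<sigma>i] permutes_inverses(2)[OF assms(1)])
qed (rule assms(2))

lemma permute_entries_Bij:
  assumes "\<sigma> permutes {1..m}"
  shows "permute_entries m Q \<sigma> \<in> Bij (ham_vertices m Q)"
proof (rule Bij_by_inverse)
  note inv = permutes_inv[OF assms]
  fix x assume x: "x \<in> ham_vertices m Q"
  show "permute_entries m Q \<sigma> x \<in> ham_vertices m Q"
    by (rule permute_entries_closed[OF assms x])
  show "permute_entries m Q (Hilbert_Choice.inv \<sigma>) x \<in> ham_vertices m Q"
    by (rule permute_entries_closed[OF inv x])
  show "permute_entries m Q (Hilbert_Choice.inv \<sigma>) (permute_entries m Q \<sigma> x) = x"
    by (rule permute_entries_inverse[OF assms x])
  show "permute_entries m Q \<sigma> (permute_entries m Q (Hilbert_Choice.inv \<sigma>) x) = x"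
    using permute_entries_inverse[OF inv x] by (simp only: permutes_inv_inv[OF assms])
qed (simp add: permute_entries_def)

text \<open>An element of the product permutes entries first and letters second. Taking
  \<open>\<sigma>\<close> to be the inverse of the entry permutation absorbs the inverse inside
  \<open>permute_entries\<close>.\<close>

lemma diag_top_group_apply:
  assumes "g \<in> diag_top_group m Q"
  obtains h \<sigma> where "h permutes Q" "\<sigma> permutes {1..m}"
    "\<And>\<alpha>. \<alpha> \<in> ham_vertices m Q \<Longrightarrow> g \<alpha> = (\<lambda>i\<in>{1..m}. h (\<alpha> (\<sigma> i)))"
proof -
  let ?V = "ham_vertices m Q"
  from assms obtain h \<tau> where h: "h permutes Q" and t: "\<tau> permutes {1..m}"
    and g: "g = entrywise m Q (\<lambda>i. h) \<otimes>\<^bsub>BijGroup ?V\<^esub> permute_entries m Q \<tau>"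
    by (auto simp: diag_top_group_def set_mult_def diag_group_def top_group_def)
  have g': "g = compose ?V (entrywise m Q (\<lambda>i. h)) (permute_entries m Q \<tau>)"
    using entrywise_Bij[OF h, of m] permute_entries_Bij[OF t, of Q] unfolding g
    by (simp add: BijGroup_def)
  have "g \<alpha> = (\<lambda>i\<in>{1..m}. h (\<alpha> (Hilbert_Choice.inv \<tau> i)))" if a: "\<alpha> \<in> ?V" for \<alpha>
  proof -
    have "g \<alpha> = entrywise m Q (\<lambda>i. h) (permute_entries m Q \<tau> \<alpha>)"
      using a by (simp add: g' compose_def)
    also have "\<dots> = (\<lambda>i\<in>{1..m}. h (permute_entries m Q \<tau> \<alpha> i))"
      using permute_entries_closed[OF t a] by (simp add: entrywise_def)
    also have "\<dots> = (\<lambda>i\<in>{1..m}. h (\<alpha> (Hilbert_Choice.inv \<tau> i)))"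
      using a by (auto simp: permute_entries_def)
    finally show ?thesis .
  qed
  then show thesis using that[OF h permutes_inv[OF t]] by blast
qed

section \<open>Letter counts and the weight\<close>

text \<open>As \<open>h\<close> is injective, \<open>\<sigma>\<close> carries the positions of
  \<open>h a\<close> in the new word bijectively onto the positions of \<open>a\<close> in
  \<open>\<alpha>\<close>.\<close>

lemma letter_count_image:
  assumes "h permutes Q" "\<sigma> permutes {1..m}"
  shows "letter_count m (h a) (\<lambda>i\<in>{1..m}. h (\<alpha> (\<sigma> i))) = letter_count m a \<alpha>"
proof -
  have inj: "inj h" using assms(1) by (rule permutes_inj)
  have image: "\<sigma> ` {i \<in> {1..m}. h (\<alpha> (\<sigma> i)) = h a} = {i \<in> {1..m}. \<alpha> i = a}"
  proof (intro equalityI subsetI)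
    fix j assume j: "j \<in> {i \<in> {1..m}. \<alpha> i = a}"
    have "j = \<sigma> (Hilbert_Choice.inv \<sigma> j)" using permutes_inverses[OF assms(2)] by simp
    moreover have "Hilbert_Choice.inv \<sigma> j \<in> {1..m}"
      using j permutes_in_image[OF permutes_inv[OF assms(2)]] by blast
    ultimately show "j \<in> \<sigma> ` {i \<in> {1..m}. h (\<alpha> (\<sigma> i)) = h a}"
      using j by (metis (mono_tags, lifting) imageI mem_Collect_eq)
  qed (use permutes_in_image[OF assms(2)] inj in \<open>auto simp: inj_eq simp del: atLeastAtMost_iff\<close>)
  have "inj_on \<sigma> {i \<in> {1..m}. h (\<alpha> (\<sigma> i)) = h a}"
    using permutes_inj[OF assms(2)] by (rule inj_on_subset) simp
  from card_image[OF this]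
  have "card {i \<in> {1..m}. h (\<alpha> (\<sigma> i)) = h a} = card {i \<in> {1..m}. \<alpha> i = a}"
    unfolding image by (rule sym)
  then show ?thesis
    by (simp add: letter_count_def cong: conj_cong)
qed

definition weight :: "nat \<Rightarrow> 'a set \<Rightarrow> (nat \<Rightarrow> 'a) \<Rightarrow> int" where
  "weight m Q \<alpha> = (\<Sum>a\<in>Q. int (letter_count m a \<alpha>) ^ 2)"

text \<open>Group elements only relabel the letter counts by \<open>h\<close>, which reindexes the
  sum of squares.\<close>

lemma weight_invariant:
  assumes "g \<in> diag_top_group m Q" "\<alpha> \<in> ham_vertices m Q"
  shows "weight m Q (g \<alpha>) = weight m Q \<alpha>"
proof -
  obtain h \<sigma> where h: "h permutes Q" and s: "\<sigma> permutes {1..m}"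
    and g: "\<And>\<alpha>. \<alpha> \<in> ham_vertices m Q \<Longrightarrow> g \<alpha> = (\<lambda>i\<in>{1..m}. h (\<alpha> (\<sigma> i)))"
    using diag_top_group_apply[OF assms(1)] by metis
  have "weight m Q (g \<alpha>) = (\<Sum>a\<in>Q. int (letter_count m (h a) (g \<alpha>)) ^ 2)"
    unfolding weight_def using h by (rule sum.permute[unfolded o_def])
  also have "\<dots> = weight m Q \<alpha>"
    unfolding weight_def g[OF assms(2)] letter_count_image[OF h s] ..
  finally show ?thesis .
qed

lemma letter_count_pos_iff: "letter_count m a \<alpha> > 0 \<longleftrightarrow> (\<exists>i\<in>{1..m}. \<alpha> i = a)"
  by (auto simp: letter_count_def card_gt_0_iff)

lemma sum_letter_count:
  assumes "finite Q" "\<alpha> \<in> ham_vertices m Q"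
  shows "(\<Sum>a\<in>Q. letter_count m a \<alpha>) = m"
proof -
  have "(\<Sum>a\<in>Q. letter_count m a \<alpha>) = (\<Sum>a\<in>Q. \<Sum>i\<in>{i \<in> {1..m}. \<alpha> i = a}. 1)"
    by (simp add: letter_count_def)
  also have "\<dots> = (\<Sum>i\<in>{1..m}. 1)"
    by (rule sum.group) (use assms in \<open>auto simp: ham_vertices_def\<close>)
  finally show ?thesis by simp
qed

lemma letter_count_upd_old:
  assumes "i \<in> {1..m}" "b \<noteq> \<alpha> i"
  shows "int (letter_count m (\<alpha> i) (\<alpha>(i := b))) = int (letter_count m (\<alpha> i) \<alpha>) - 1"
proof -
  have "{j \<in> {1..m}. \<alpha> j = \<alpha> i} = insert i {j \<in> {1..m}. (\<alpha>(i := b)) j = \<alpha> i}"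
    using assms by auto
  moreover have "i \<notin> {j \<in> {1..m}. (\<alpha>(i := b)) j = \<alpha> i}" using assms by auto
  ultimately show ?thesis by (simp add: letter_count_def)
qed

lemma letter_count_upd_new:
  assumes "i \<in> {1..m}" "b \<noteq> \<alpha> i"
  shows "letter_count m b (\<alpha>(i := b)) = Suc (letter_count m b \<alpha>)"
proof -
  have "{j \<in> {1..m}. (\<alpha>(i := b)) j = b} = insert i {j \<in> {1..m}. \<alpha> j = b}"
    using assms by auto
  then show ?thesis using assms by (simp add: letter_count_def)
qed

lemma letter_count_upd_other:
  "c \<noteq> \<alpha> i \<Longrightarrow> c \<noteq> b \<Longrightarrow> letter_count m c (\<alpha>(i := b)) = letter_count m c \<alpha>"
  unfolding letter_count_def by (rule arg_cong[where f = card]) auto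

text \<open>Half the weight change caused by writing \<open>b\<close> at position \<open>i\<close>.
  This reading needs \<open>b \<noteq> \<alpha> i\<close>; for \<open>b = \<alpha> i\<close> the
  value is 1 although nothing changes.\<close>

definition excess :: "nat \<Rightarrow> (nat \<Rightarrow> 'a) \<Rightarrow> nat \<Rightarrow> 'a \<Rightarrow> int" where
  "excess m \<alpha> i b = int (letter_count m b \<alpha>) - int (letter_count m (\<alpha> i) \<alpha>) + 1"

text \<open>Only two counts change, and (x - 1)^2 + (y + 1)^2 - x^2 - y^2 = 2 (y - x + 1).\<close>

lemma weight_upd:
  assumes "finite Q" "i \<in> {1..m}" "\<alpha> i \<in> Q" "b \<in> Q" "b \<noteq> \<alpha> i"
  shows "weight m Q (\<alpha>(i := b)) = weight m Q \<alpha> + 2 * excess m \<alpha> i b"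
proof -
  have split: "weight m Q \<beta> = int (letter_count m (\<alpha> i) \<beta>) ^ 2 + int (letter_count m b \<beta>) ^ 2
      + (\<Sum>c\<in>Q - {\<alpha> i, b}. int (letter_count m c \<beta>) ^ 2)" for \<beta>
  proof -
    have Q: "Q = insert (\<alpha> i) (insert b (Q - {\<alpha> i, b}))" using assms by auto
    show ?thesis unfolding weight_def
      by (subst Q, subst sum.insert) (use assms in auto)
  qed
  have "(\<Sum>c\<in>Q - {\<alpha> i, b}. int (letter_count m c (\<alpha>(i := b))) ^ 2)
      = (\<Sum>c\<in>Q - {\<alpha> i, b}. int (letter_count m c \<alpha>) ^ 2)"
    by (rule sum.cong) (auto simp: letter_count_upd_other)
  then show ?thesis
    unfolding split[of \<alpha>] split[of "\<alpha>(i := b)"] letter_count_upd_old[where \<alpha> = \<alpha>, OF assms(2,5)]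
      letter_count_upd_new[where \<alpha> = \<alpha>, OF assms(2,5)] excess_def
    by (simp add: power2_eq_square algebra_simps)
qed

section \<open>From neighbour transitivity to a rule for single-entry changes\<close>

text \<open>The trace of neighbour transitivity that no longer mentions the group: \<open>D\<close>
  is half the weight difference between neighbours and codewords.\<close>

definition uniform_moves :: "nat \<Rightarrow> 'a set \<Rightarrow> (nat \<Rightarrow> 'a) set \<Rightarrow> int \<Rightarrow> bool" where
  "uniform_moves m Q C D \<longleftrightarrow> D \<noteq> 0 \<and>
     (\<forall>\<alpha>\<in>C. \<forall>i\<in>{1..m}. \<forall>b\<in>Q - {\<alpha> i}. excess m \<alpha> i b = (if \<alpha>(i := b) \<in> C then 0 else D))"

lemma exists_other_letter:
  assumes "card Q \<ge> 2"
  shows "\<exists>b\<in>Q. b \<noteq> a"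
proof (rule ccontr)
  assume "\<not> ?thesis"
  then have "Q \<subseteq> {a}" by auto
  then have "card Q \<le> card {a}" by (rule card_mono[rotated]) simp
  then show False using assms by simp
qed

text \<open>This will give \<open>D \<noteq> 0\<close>. For two letters that both occur, the
  excesses of the two opposite changes add up to 2, so if all vanish the word is constant. Then
  introducing a new letter has excess 1 - m, which is not 0.\<close>

lemma some_excess_nonzero:
  assumes "m \<ge> 2" "finite Q" "card Q \<ge> 2" "\<alpha> \<in> ham_vertices m Q"
  shows "\<exists>i\<in>{1..m}. \<exists>b\<in>Q - {\<alpha> i}. excess m \<alpha> i b \<noteq> 0"
proof (rule ccontr)
  assume "\<not> ?thesis"
  then have zero: "excess m \<alpha> i b = 0" if "i \<in> {1..m}" "b \<in> Q" "b \<noteq> \<alpha> i" for i b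
    using that by blast
  have in_Q: "\<alpha> i \<in> Q" if "i \<in> {1..m}" for i using assms(4) that by (auto simp: ham_vertices_def)
  have same: "\<alpha> i = \<alpha> j" if "i \<in> {1..m}" "j \<in> {1..m}" for i j
    using zero[of i "\<alpha> j"] zero[of j "\<alpha> i"] in_Q that by (force simp: excess_def)
  have one: "1 \<in> {1..m}" using assms(1) by auto
  obtain b where b: "b \<in> Q" "b \<noteq> \<alpha> 1"
    using exists_other_letter[OF assms(3)] by blast
  have "letter_count m b \<alpha> = 0"
    using letter_count_pos_iff[of m b \<alpha>] same[OF _ one] b(2) by (metis gr0I)
  moreover have "letter_count m (\<alpha> 1) \<alpha> = m"
  proof -
    have "{i \<in> {1..m}. \<alpha> i = \<alpha> 1} = {1..m}" using same[OF _ one] by blast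
    then show ?thesis by (simp add: letter_count_def)
  qed
  ultimately show False using zero[OF one b] assms(1) by (simp add: excess_def)
qed

lemma neighbour_transitive_orbitsD:
  assumes "neighbour_transitive m Q X C"
  obtains x y where "x \<in> ham_vertices m Q" "C = {g x | g. g \<in> X}"
    "y \<in> ham_vertices m Q" "neighbour_set m Q C = {g y | g. g \<in> X}"
proof -
  have "\<exists>x \<in> ham_vertices m Q. C = {g x | g. g \<in> X}"
    "\<exists>y \<in> ham_vertices m Q. neighbour_set m Q C = {g y | g. g \<in> X}"
    using assms by (auto simp: neighbour_transitive_def Let_def orbits_def orbit_def)
  then show thesis using that by blast
qed

lemma Bij_subgroup_one_mem:
  assumes "subgroup X (BijGroup V)"
  shows "(\<lambda>x\<in>V. x) \<in> X"
  using subgroup.one_closed[OF assms] by (simp add: BijGroup_def)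

lemma orbit_image_closed:
  assumes X: "subgroup X (BijGroup V)" and "g \<in> X" "x \<in> V" "\<alpha> \<in> {k x | k. k \<in> X}"
  shows "g \<alpha> \<in> {k x | k. k \<in> X}"
proof -
  obtain k where k: "k \<in> X" "\<alpha> = k x" using assms(4) by auto
  have "X \<subseteq> Bij V" using subgroup.subset[OF X] by (simp add: BijGroup_def)
  then have "g \<otimes>\<^bsub>BijGroup V\<^esub> k = compose V g k"
    using assms(2) k(1) by (auto simp: BijGroup_def)
  then have "compose V g k \<in> X" using subgroup.m_closed[OF X assms(2) k(1)] by simp
  moreover have "compose V g k x = g \<alpha>" using assms(3) k(2) by (simp add: compose_def)
  ultimately show ?thesis by (metis (mono_tags, lifting) mem_Collect_eq)
qed

text \<open>If \<open>k\<close> and \<open>l\<close> send \<open>x\<close> to the two points, then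
  \<open>l\<close> after the inverse of \<open>k\<close> serves.\<close>

lemma orbit_transitive:
  assumes X: "subgroup X (BijGroup V)" and "x \<in> V"
    and "\<alpha> \<in> {k x | k. k \<in> X}" "\<beta> \<in> {k x | k. k \<in> X}"
  obtains g where "g \<in> X" "g \<alpha> = \<beta>"
proof -
  obtain k where k: "k \<in> X" "\<alpha> = k x" using assms(3) by auto
  obtain l where l: "l \<in> X" "\<beta> = l x" using assms(4) by auto
  let ?k' = "inv\<^bsub>BijGroup V\<^esub> k"
  have sub: "X \<subseteq> Bij V" using subgroup.subset[OF X] by (simp add: BijGroup_def)
  have k': "?k' \<in> X" using subgroup.m_inv_closed[OF X k(1)] .
  have kB: "k \<in> Bij V" and k'B: "?k' \<in> Bij V" and lB: "l \<in> Bij V"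
    using k(1) k' l(1) sub by blast+
  have "k \<in> carrier (BijGroup V)" using kB by (simp add: BijGroup_def)
  from group.l_inv[OF group_BijGroup this]
  have "compose V ?k' k = (\<lambda>x\<in>V. x)"
    using kB k'B unfolding BijGroup_def by simp
  then have "compose V ?k' k x = x" using assms(2) by simp
  then have k'x: "?k' (k x) = x" using assms(2) by (simp only: compose_eq)
  have kx: "k x \<in> V" using kB assms(2) by (auto simp: Bij_def bij_betw_def)
  have "l \<otimes>\<^bsub>BijGroup V\<^esub> ?k' = compose V l ?k'"
    using lB k'B by (simp add: BijGroup_def)
  then have "compose V l ?k' \<in> X" using subgroup.m_closed[OF X l(1) k'] by simp
  moreover have "compose V l ?k' \<alpha> = \<beta>"
    unfolding k(2) l(2) compose_eq[OF kx] k'x ..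
  ultimately show thesis by (rule that)
qed

lemma neighbour_transitive_uniform_moves:
  assumes "m \<ge> 2" "finite Q" "card Q \<ge> 2" "C \<subseteq> ham_vertices m Q"
    and "X \<subseteq> diag_top_group m Q" "neighbour_transitive m Q X C" "C \<noteq> {}"
  shows "\<exists>D. uniform_moves m Q C D"
proof -
  let ?V = "ham_vertices m Q"
  obtain x y where x: "x \<in> ?V" "C = {g x | g. g \<in> X}"
    and y: "y \<in> ?V" "neighbour_set m Q C = {g y | g. g \<in> X}"
    using neighbour_transitive_orbitsD[OF assms(6)] .
  have wC: "weight m Q \<alpha> = weight m Q x" if "\<alpha> \<in> C" for \<alpha>
    using that weight_invariant[OF _ x(1)] assms(5) unfolding x(2) by auto
  have wN: "weight m Q \<alpha> = weight m Q y" if "\<alpha> \<in> neighbour_set m Q C" for \<alpha>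
    using that weight_invariant[OF _ y(1)] assms(5) unfolding y(2) by auto
  \<comment> \<open>The division is exact wherever \<open>D\<close> is used: a move out of
    \<open>C\<close> shows that the difference is twice an excess.\<close>
  define D where "D = (weight m Q y - weight m Q x) div 2"
  have move: "excess m \<alpha> i b = (if \<alpha>(i := b) \<in> C then 0 else D)"
    if "\<alpha> \<in> C" "i \<in> {1..m}" "b \<in> Q - {\<alpha> i}" for \<alpha> i b
  proof -
    have a: "\<alpha> \<in> ?V" using assms(4) that(1) by auto
    then have "\<alpha> i \<in> Q" using that by (auto simp: ham_vertices_def)
    then have W: "weight m Q (\<alpha>(i := b)) = weight m Q x + 2 * excess m \<alpha> i b"
      using weight_upd[of Q i m \<alpha> b] that wC assms(2) by auto
    show ?thesis
    proof (cases "\<alpha>(i := b) \<in> C")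
      case True
      then show ?thesis using W wC[OF True] by simp
    next
      case False
      then have "\<alpha>(i := b) \<in> neighbour_set m Q C"
        using that ham_vertices_upd[OF a] ham_adj_upd[of i m b \<alpha>] by (auto simp: neighbour_set_def)
      then show ?thesis using W wN[of "\<alpha>(i := b)"] False by (simp add: D_def)
    qed
  qed
  obtain \<alpha> where "\<alpha> \<in> C" using assms(7) by auto
  then have "D \<noteq> 0" using some_excess_nonzero[of m Q \<alpha>] move assms(1-4)
    by (metis subsetD)
  then show ?thesis using move unfolding uniform_moves_def by blast
qed

section \<open>Possible letter counts of a codeword\<close>

text \<open>Each shape is recorded with its value of \<open>D\<close>, because \<open>D\<close> is
  common to all codewords and so transfers information from one codeword to the others.\<close>

lemma uniform_moves_shape:
  assumes m: "m \<ge> 2" and Q: "finite Q" "card Q \<ge> 2" and \<alpha>: "\<alpha> \<in> ham_vertices m Q" "\<alpha> \<in> C"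
    and U: "uniform_moves m Q C D"
  shows "(D = 1 \<and> (\<exists>p>0. \<forall>a\<in>Q. letter_count m a \<alpha> = p))
       \<or> (D < 0 \<and> (\<exists>a\<in>Q. \<alpha> = const_word m a))
       \<or> (D = 1 \<and> \<alpha> \<in> Inj m Q \<and> (\<exists>b\<in>Q. letter_count m b \<alpha> = 0))
       \<or> (D = 2 \<and> (\<exists>k>0. \<exists>a b. Q = {a, b} \<and> a \<noteq> b
            \<and> letter_count m a \<alpha> = Suc k \<and> letter_count m b \<alpha> = k))"
proof -
  define n where "n = (\<lambda>a. letter_count m a \<alpha>)"
  have D0: "D \<noteq> 0" using U by (simp add: uniform_moves_def)
  have in_Q: "\<alpha> i \<in> Q" if "i \<in> {1..m}" for i using \<alpha>(1) that by (auto simp: ham_vertices_def)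
  have n_pos: "n (\<alpha> i) > 0" if "i \<in> {1..m}" for i using that by (auto simp: n_def letter_count_pos_iff)
  \<comment> \<open>The rule restated for letters; \<open>n a > 0\<close> supplies a position at
    which \<open>a\<close> can be replaced.\<close>
  have mv: "int (n b) - int (n a) + 1 = 0 \<or> int (n b) - int (n a) + 1 = D"
    if ab: "a \<in> Q" "b \<in> Q" "a \<noteq> b" "n a > 0" for a b
  proof -
    obtain i where i: "i \<in> {1..m}" "\<alpha> i = a" using ab(4) by (auto simp: n_def letter_count_pos_iff)
    have "excess m \<alpha> i b = 0 \<or> excess m \<alpha> i b = D"
      using U \<alpha>(2) i ab unfolding uniform_moves_def by (metis Diff_iff singletonD)
    then show ?thesis using i by (simp add: excess_def n_def)
  qed
  have one: "1 \<in> {1..m}" and two: "2 \<in> {1..m}" using m by auto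
  have other: "\<exists>b\<in>Q. b \<noteq> a" for a
    using exists_other_letter[OF Q(2)] .
  consider (zero) b where "b \<in> Q" "n b = 0" | (pos) "\<forall>b\<in>Q. n b > 0" by blast
  then show ?thesis
  proof cases
    case zero
    \<comment> \<open>Replacing \<open>a\<close> by the absent letter \<open>b\<close> has excess
      \<open>1 - n a\<close>.\<close>
    have vals: "n a = 1 \<or> int (n a) = 1 - D" if "a \<in> Q" "n a > 0" for a
      using mv[of a b] zero that by force
    show ?thesis
    proof (cases "\<exists>a\<in>Q. n a \<ge> 2")
      case True
      then obtain a where a: "a \<in> Q" "n a \<ge> 2" by auto
      then have D: "int (n a) = 1 - D" using vals[of a] by auto
      \<comment> \<open>If \<open>c\<close> occurred, \<open>vals\<close> would give
        \<open>n c \<le> n a\<close>, so changing \<open>c\<close> to \<open>a\<close> has positive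
        excess. But the only allowed values are 0 and \<open>D = 1 - n a < 0\<close>.\<close>
      have "n c = 0" if "c \<in> Q" "c \<noteq> a" for c
        using mv[of c a] vals[of c] that a D by force
      then have "\<alpha> i = a" if "i \<in> {1..m}" for i using n_pos[OF that] in_Q[OF that] by force
      then have "\<alpha> = const_word m a"
        using \<alpha>(1) by (auto simp: const_word_def ham_vertices_def PiE_iff extensional_def)
      then show ?thesis using D a by auto
    next
      case False
      then have le: "n a \<le> 1" if "a \<in> Q" for a using that by force
      have inj: "inj_on \<alpha> {1..m}"
      proof (rule inj_onI)
        fix i j assume ij: "i \<in> {1..m}" "j \<in> {1..m}" "\<alpha> i = \<alpha> j"
        have "card {l \<in> {1..m}. \<alpha> l = \<alpha> i} \<le> Suc 0"
          using le[OF in_Q[OF ij(1)]] by (simp add: n_def letter_count_def)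
        then show "i = j" using ij by (subst (asm) card_le_Suc0_iff_eq) auto
      qed
      then have ne: "\<alpha> 1 \<noteq> \<alpha> 2" using one two by (auto dest: inj_onD)
      have "n (\<alpha> 1) = 1" "n (\<alpha> 2) = 1"
        using n_pos[OF one] n_pos[OF two] le[OF in_Q[OF one]] le[OF in_Q[OF two]] by auto
      then have "D = 1" using mv[OF in_Q[OF one] in_Q[OF two] ne] by simp
      then show ?thesis using inj \<alpha>(1) zero by (auto simp: Inj_def n_def)
    qed
  next
    case pos
    show ?thesis
    proof (cases "\<forall>a\<in>Q. \<forall>b\<in>Q. n a = n b")
      case True
      define p where "p = n (\<alpha> 1)"
      have all: "\<forall>a\<in>Q. n a = p" using True in_Q[OF one] unfolding p_def by blast
      obtain b where "b \<in> Q" "b \<noteq> \<alpha> 1" using other by blast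
      then have "D = 1" using mv[OF in_Q[OF one], of b] n_pos[OF one] all in_Q[OF one] by auto
      moreover have "p > 0" using n_pos[OF one] by (simp add: p_def)
      ultimately show ?thesis using all by (auto simp: n_def)
    next
      case False
      then obtain a b where ab: "a \<in> Q" "b \<in> Q" "n b < n a"
        by (metis linorder_neqE_nat)
      \<comment> \<open>Changing \<open>b\<close> to \<open>a\<close> has excess at least 2, hence
        exactly \<open>D\<close>. The opposite change has excess at most 0, hence exactly 0.\<close>
      have D: "D = 2" "n a = Suc (n b)"
        using mv[of a b] mv[of b a] ab pos by force+
      \<comment> \<open>The excesses from a third letter to \<open>a\<close> and to \<open>b\<close>
        would differ by 1, yet both would lie in {0, 2}.\<close>
      have "c = a \<or> c = b" if c: "c \<in> Q" for c
      proof (rule ccontr)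
        assume ne: "\<not> (c = a \<or> c = b)"
        have "n c > 0" using pos c by blast
        then show False using mv[of c a] mv[of c b] ab(1,2) c ne D by auto
      qed
      then have "Q = {a, b}" using ab by auto
      then have "n b > 0 \<and> Q = {a, b} \<and> a \<noteq> b \<and> n a = Suc (n b) \<and> n b = n b"
        using D ab pos by auto
      then show ?thesis using D(1) unfolding n_def by blast
    qed
  qed
qed

section \<open>Connectivity of injective words and of nearly balanced binary words\<close>

text \<open>As \<open>D\<close> is non-zero, excess 0 rules out leaving \<open>C\<close>.\<close>

lemma uniform_moves_closed:
  assumes "uniform_moves m Q C D" "\<alpha> \<in> C" "i \<in> {1..m}" "b \<in> Q" "b \<noteq> \<alpha> i" "excess m \<alpha> i b = 0"
  shows "\<alpha>(i := b) \<in> C"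
  using assms unfolding uniform_moves_def by (metis Diff_iff singletonD)

definition ham_dist :: "nat \<Rightarrow> (nat \<Rightarrow> 'a) \<Rightarrow> (nat \<Rightarrow> 'a) \<Rightarrow> nat" where
  "ham_dist m \<alpha> \<beta> = card {i \<in> {1..m}. \<alpha> i \<noteq> \<beta> i}"

lemma ham_dist_upd_less:
  assumes "i \<in> {1..m}" "\<alpha> i \<noteq> \<beta> i"
  shows "ham_dist m (\<alpha>(i := \<beta> i)) \<beta> < ham_dist m \<alpha> \<beta>"
  unfolding ham_dist_def by (rule psubset_card_mono) (use assms in auto)

lemma ham_dist_upd_le:
  assumes "i \<in> {1..m}" "\<alpha> i \<noteq> \<beta> i"
  shows "ham_dist m (\<alpha>(i := u)) \<beta> \<le> ham_dist m \<alpha> \<beta>"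
  unfolding ham_dist_def by (rule card_mono) (use assms in auto)

text \<open>Connectivity by descent on the distance to the target. The closer codeword need not be
  adjacent, which leaves room for a detour of two moves.\<close>

lemma reach_by_decreasing_ham_dist:
  assumes C: "C \<subseteq> ham_vertices m Q" and \<beta>: "\<beta> \<in> ham_vertices m Q" and "\<alpha> \<in> C"
    and closer: "\<And>\<alpha>. \<alpha> \<in> C \<Longrightarrow> \<alpha> \<noteq> \<beta> \<Longrightarrow> \<exists>\<alpha>'\<in>C. ham_dist m \<alpha>' \<beta> < ham_dist m \<alpha> \<beta>"
  shows "\<beta> \<in> C"
  using \<open>\<alpha> \<in> C\<close>
proof (induction "ham_dist m \<alpha> \<beta>" arbitrary: \<alpha> rule: less_induct)
  case less
  then show ?case using closer[of \<alpha>] by blast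
qed

lemma Inj_closed_under_moves:
  assumes m: "m < card Q" and Q: "finite Q" and C: "C \<subseteq> Inj m Q" "C \<noteq> {}"
    and U: "uniform_moves m Q C D"
  shows "C = Inj m Q"
proof (rule equalityI[OF C(1)], rule subsetI)
  fix \<beta> assume \<beta>: "\<beta> \<in> Inj m Q"
  have mv: "\<alpha>(i := b) \<in> C" if "\<alpha> \<in> C" "i \<in> {1..m}" "b \<in> Q - \<alpha> ` {1..m}" for \<alpha> i b
  proof -
    have inj: "inj_on \<alpha> {1..m}" using that C(1) by (auto simp: Inj_def)
    have "{l \<in> {1..m}. \<alpha> l = \<alpha> i} = {i}" using inj that(2) by (auto dest: inj_onD)
    moreover have "letter_count m b \<alpha> = 0" using that letter_count_pos_iff[of m b \<alpha>] by auto
    ultimately have "excess m \<alpha> i b = 0" by (simp add: excess_def letter_count_def)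
    then show ?thesis using uniform_moves_closed[OF U] that by blast
  qed
  obtain \<alpha>\<^sub>0 where \<alpha>0: "\<alpha>\<^sub>0 \<in> C" using C(2) by auto
  show "\<beta> \<in> C"
  proof (rule reach_by_decreasing_ham_dist[OF _ _ \<alpha>0])
    show "C \<subseteq> ham_vertices m Q" "\<beta> \<in> ham_vertices m Q" using C \<beta> by (auto simp: Inj_def)
    fix \<alpha> assume \<alpha>: "\<alpha> \<in> C" "\<alpha> \<noteq> \<beta>"
    then obtain i where i: "i \<in> {1..m}" "\<alpha> i \<noteq> \<beta> i"
      using ham_vertices_eqI[of \<alpha> m Q \<beta>] C \<beta> by (auto simp: Inj_def)
    have bi: "\<beta> i \<in> Q" using \<beta> i by (auto simp: Inj_def ham_vertices_def)
    show "\<exists>\<alpha>'\<in>C. ham_dist m \<alpha>' \<beta> < ham_dist m \<alpha> \<beta>"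
    proof (cases "\<beta> i \<in> \<alpha> ` {1..m}")
      case False
      then show ?thesis using mv[OF \<alpha>(1) i(1), of "\<beta> i"] ham_dist_upd_less[where \<alpha>=\<alpha> and \<beta>=\<beta>, OF i] bi by blast
    next
      case True
      then obtain j where j: "j \<in> {1..m}" "\<beta> i = \<alpha> j" by auto
      have ij: "i \<noteq> j" using i j by auto
      \<comment> \<open>Injectivity of \<open>\<beta>\<close> makes \<open>j\<close> a wrong
        position too, so overwriting it does not increase the distance.\<close>
      then have bj: "\<alpha> j \<noteq> \<beta> j" using \<beta> i(1) j inj_onD[of \<beta> "{1..m}" i j] by (auto simp: Inj_def)
      have "card (\<alpha> ` {1..m}) < card Q" using m card_image_le[of "{1..m}" \<alpha>] by simp
      then have "\<not> Q \<subseteq> \<alpha> ` {1..m}" using card_mono[of "\<alpha> ` {1..m}" Q] by auto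
      then obtain u where u: "u \<in> Q" "u \<notin> \<alpha> ` {1..m}" by auto
      let ?\<gamma> = "\<alpha>(j := u)"
      have g: "?\<gamma> \<in> C" using mv[OF \<alpha>(1) j(1)] u by blast
      have "inj_on \<alpha> {1..m}" using \<alpha> C by (auto simp: Inj_def)
      then have "\<beta> i \<notin> ?\<gamma> ` {1..m}" using j u by (auto dest: inj_onD)
      then have "?\<gamma>(i := \<beta> i) \<in> C" using mv[OF g i(1)] bi by blast
      moreover have "?\<gamma> i \<noteq> \<beta> i" using i ij by simp
      then have "ham_dist m (?\<gamma>(i := \<beta> i)) \<beta> < ham_dist m ?\<gamma> \<beta>"
        using ham_dist_upd_less[of i m ?\<gamma> \<beta>] i(1) by blast
      moreover have "ham_dist m ?\<gamma> \<beta> \<le> ham_dist m \<alpha> \<beta>" using ham_dist_upd_le[where \<alpha>=\<alpha> and \<beta>=\<beta>, OF j(1) bj] .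
      ultimately show ?thesis by (meson order_less_le_trans)
    qed
  qed
qed

lemma letter_count_two_letters:
  assumes "Q = {a, b}" "a \<noteq> b" "\<alpha> \<in> ham_vertices m Q"
  shows "letter_count m a \<alpha> + letter_count m b \<alpha> = m"
  using sum_letter_count[of Q \<alpha> m] assms by simp

text \<open>The two counts add up to the odd number \<open>m\<close>, so the two admissible values
  mean that they differ by one. This form is symmetric in the letters, so the code does not depend
  on which letter plays 1.\<close>

lemma W_half_iff:
  assumes Q: "card Q = 2" and ab: "a \<in> Q" "b \<in> Q" "a \<noteq> b" and m: "m = 2 * k + 1"
  shows "\<alpha> \<in> W_half m Q b \<longleftrightarrow> \<alpha> \<in> ham_vertices m Q \<and>
    (letter_count m a \<alpha> = Suc (letter_count m b \<alpha>) \<or> letter_count m b \<alpha> = Suc (letter_count m a \<alpha>))"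
proof -
  have "Q = {a, b}" using Q ab by (auto simp: card_2_iff)
  then show ?thesis using letter_count_two_letters[of Q a b \<alpha> m] ab m by (auto simp: W_half_def)
qed

text \<open>Turning one majority letter into the minority letter has excess 0 and exchanges the two
  roles. Such a move can always be made at a position where the target has the minority
  letter.\<close>

lemma W_half_closed_under_moves:
  assumes Q: "card Q = 2" and b\<^sub>0: "b\<^sub>0 \<in> Q" and m: "m = 2 * k + 1"
    and C: "C \<subseteq> W_half m Q b\<^sub>0" "C \<noteq> {}" and U: "uniform_moves m Q C D"
  shows "C = W_half m Q b\<^sub>0"
proof (rule equalityI[OF C(1)], rule subsetI)
  fix \<beta> assume \<beta>: "\<beta> \<in> W_half m Q b\<^sub>0"
  obtain a\<^sub>0 where a0: "a\<^sub>0 \<in> Q" "a\<^sub>0 \<noteq> b\<^sub>0" using Q b\<^sub>0 by (metis card_2_iff')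
  have Q2: "Q = {a\<^sub>0, b\<^sub>0}" using Q b\<^sub>0 a0 by (auto simp: card_2_iff)
  note W = W_half_iff[OF Q a0(1) b\<^sub>0 a0(2) m]
  obtain \<alpha>\<^sub>0 where \<alpha>0: "\<alpha>\<^sub>0 \<in> C" using C(2) by auto
  have \<beta>V: "\<beta> \<in> ham_vertices m Q" using \<beta> W by blast
  show "\<beta> \<in> C"
  proof (rule reach_by_decreasing_ham_dist[OF _ \<beta>V \<alpha>0])
    show "C \<subseteq> ham_vertices m Q" using C W by auto
    fix \<alpha> assume \<alpha>: "\<alpha> \<in> C" "\<alpha> \<noteq> \<beta>"
    have \<alpha>W: "\<alpha> \<in> W_half m Q b\<^sub>0" using \<alpha> C by auto
    then have \<alpha>V: "\<alpha> \<in> ham_vertices m Q" using W by blast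
    \<comment> \<open>Here \<open>a\<close> is the majority letter of the current word
      \<open>\<alpha>\<close>, so the pair may be either ordering of \<open>a\<^sub>0\<close> and
      \<open>b\<^sub>0\<close>.\<close>
    obtain a b where ab: "Q = {a, b}" "a \<noteq> b" "letter_count m a \<alpha> = Suc (letter_count m b \<alpha>)"
      using \<alpha>W[unfolded W] Q2 a0(2) by (metis insert_commute)
    have "letter_count m b \<alpha> \<le> letter_count m b \<beta>"
    proof -
      have "letter_count m a \<beta> = Suc (letter_count m b \<beta>) \<or> letter_count m b \<beta> = Suc (letter_count m a \<beta>)"
        using \<beta>[unfolded W] Q2 ab(1) by (metis doubleton_eq_iff)
      then show ?thesis
        using letter_count_two_letters[OF ab(1,2) \<alpha>V] letter_count_two_letters[OF ab(1,2) \<beta>V] ab(3) by linarith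
    qed
    have "\<exists>i\<in>{1..m}. \<alpha> i = a \<and> \<beta> i = b"
    proof (rule ccontr)
      assume no: "\<not> ?thesis"
      have val: "\<gamma> i = a \<or> \<gamma> i = b" if "\<gamma> \<in> ham_vertices m Q" "i \<in> {1..m}" for \<gamma> i
        using that ab(1) by (auto simp: ham_vertices_def)
      \<comment> \<open>Otherwise the positions of \<open>b\<close> in \<open>\<beta>\<close> lie
        among those in \<open>\<alpha>\<close>. By the count they coincide, and with two letters the
        words agree.\<close>
      have "{i \<in> {1..m}. \<beta> i = b} \<subseteq> {i \<in> {1..m}. \<alpha> i = b}" using no val[OF \<alpha>V] by blast
      then have "{i \<in> {1..m}. \<beta> i = b} = {i \<in> {1..m}. \<alpha> i = b}"
        using \<open>letter_count m b \<alpha> \<le> letter_count m b \<beta>\<close>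
        by (intro card_seteq) (auto simp: letter_count_def)
      then have "\<beta> i = b \<longleftrightarrow> \<alpha> i = b" if "i \<in> {1..m}" for i
        using that by blast
      then have "\<alpha> i = \<beta> i" if "i \<in> {1..m}" for i
        using val[OF \<alpha>V that] val[OF \<beta>V that] that by metis
      then show False using \<alpha>(2) ham_vertices_eqI[OF \<alpha>V \<beta>V] by blast
    qed
    then obtain i where i: "i \<in> {1..m}" "\<alpha> i = a" "\<beta> i = b" by auto
    then have "excess m \<alpha> i b = 0" using ab by (simp add: excess_def)
    then have "\<alpha>(i := b) \<in> C" using uniform_moves_closed[OF U \<alpha>(1) i(1)] ab i by auto
    moreover have "ham_dist m (\<alpha>(i := b)) \<beta> < ham_dist m \<alpha> \<beta>"
      using ham_dist_upd_less[of i m \<alpha> \<beta>] i ab by auto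
    ultimately show "\<exists>\<alpha>'\<in>C. ham_dist m \<alpha>' \<beta> < ham_dist m \<alpha> \<beta>" by blast
  qed
qed

text \<open>
  If \<open>C\<close> contains \<open>(a,\<dots>,a)\<close> and \<open>(b,\<dots>,b)\<close> but not \<open>(c,\<dots>,c)\<close>, no element of \<open>X\<close> maps the
  neighbour \<open>(b,a,\<dots>,a)\<close> to \<open>(c,a,\<dots>,a)\<close>, because its letter permutation preserves the letters
  of \<open>C\<close>.
\<close>

lemma neighbour_transitive_subset_Rep:
  assumes m: "m \<ge> 2" and X: "subgroup X (BijGroup (ham_vertices m Q))" "X \<subseteq> diag_top_group m Q"
    and N: "neighbour_transitive m Q X C" and C: "C \<subseteq> Rep m Q" "C \<noteq> {}"
  shows "(\<exists>a\<in>Q. C = {const_word m a}) \<or> C = Rep m Q"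
proof (rule ccontr)
  assume no: "\<not> ?thesis"
  let ?V = "ham_vertices m Q"
  have V: "const_word m a \<in> ?V" if "a \<in> Q" for a
    using that by (auto simp: const_word_def ham_vertices_def)
  obtain a where a: "a \<in> Q" "const_word m a \<in> C" using C by (auto simp: Rep_def)
  obtain b where b: "b \<in> Q" "const_word m b \<in> C" "b \<noteq> a"
  proof -
    have "C \<noteq> {const_word m a}" using no a(1) by blast
    then obtain w where "w \<in> C" "w \<noteq> const_word m a" using a(2) by blast
    moreover from this C(1) obtain b where "b \<in> Q" "w = const_word m b" by (auto simp: Rep_def)
    ultimately show thesis using that by blast
  qed
  obtain c where c: "c \<in> Q" "const_word m c \<notin> C" using no C by (auto simp: Rep_def)
  obtain x y where x: "x \<in> ?V" "C = {g x | g. g \<in> X}"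
    and y: "y \<in> ?V" "neighbour_set m Q C = {g y | g. g \<in> X}"
    using neighbour_transitive_orbitsD[OF N] .
  have one: "1 \<in> {1..m}" and two: "2 \<in> {1..m}" using m by auto
  \<comment> \<open>\<open>w d\<close> is the word (d, a, ..., a). Its second entry, available as
    \<open>m \<ge> 2\<close>, keeps it from being constant when \<open>d \<noteq> a\<close>.\<close>
  define w where "w = (\<lambda>d. (const_word m a)(1 := d))"
  have wV: "w d \<in> ?V" if "d \<in> Q" for d
    unfolding w_def using ham_vertices_upd[OF V[OF a(1)] one that] .
  have nb: "w d \<in> neighbour_set m Q C" if "d \<in> Q" "d \<noteq> a" for d
  proof -
    have "w d \<notin> C"
    proof
      assume "w d \<in> C"
      then obtain e where "w d = const_word m e" using C by (auto simp: Rep_def)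
      then have "w d 1 = w d 2" using one two by (simp add: const_word_def)
      then show False using that one two by (simp add: w_def const_word_def)
    qed
    moreover have "ham_adj m (const_word m a) (w d)"
      unfolding w_def using that one by (intro ham_adj_upd) (auto simp: const_word_def)
    ultimately show ?thesis using wV that a by (auto simp: neighbour_set_def)
  qed
  have "c \<noteq> a" using a c by auto
  then obtain g where g: "g \<in> X" "g (w b) = w c"
    using orbit_transitive[OF X(1) y(1)] nb b c y(2) by metis
  obtain h \<sigma> where s: "\<sigma> permutes {1..m}"
    and gh: "\<And>\<alpha>. \<alpha> \<in> ?V \<Longrightarrow> g \<alpha> = (\<lambda>i\<in>{1..m}. h (\<alpha> (\<sigma> i)))"
    using diag_top_group_apply g(1) X(2) by (metis subsetD)
  have s1: "\<sigma> i \<in> {1..m}" if "i \<in> {1..m}" for i using that permutes_in_image[OF s] by blast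
  have pres: "const_word m (h d) \<in> C" if d: "d \<in> Q" "const_word m d \<in> C" for d
  proof -
    have "g (const_word m d) = const_word m (h d)"
      using gh[OF V[OF d(1)]] s1 by (auto simp: const_word_def)
    then show ?thesis using orbit_image_closed[OF X(1) g(1) x(1)] d(2) x(2) by metis
  qed
  \<comment> \<open>The entry \<open>c\<close> is the image under \<open>h\<close> of an entry of
    \<open>w b\<close>, that is, of \<open>a\<close> or \<open>b\<close>; by \<open>pres\<close> its
    constant word would lie in \<open>C\<close>.\<close>
  have "c = w c 1" by (simp add: w_def)
  also have "\<dots> = h (w b (\<sigma> 1))" using gh[OF wV[OF b(1)]] g(2) one by (metis restrict_apply')
  finally have "c = h (w b (\<sigma> 1))" .
  moreover have "w b (\<sigma> 1) = a \<or> w b (\<sigma> 1) = b" using s1[OF one] by (auto simp: w_def const_word_def)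
  ultimately show False using pres a b c by auto
qed

theorem theorem4p3:
  fixes m q :: nat
    and Q :: "'a set"
    and C :: "(nat \<Rightarrow> 'a) set"
    and X :: "((nat \<Rightarrow> 'a) \<Rightarrow> (nat \<Rightarrow> 'a)) set"
  assumes "m \<ge> 2" and "q \<ge> 2"
    and "finite Q" and "card Q = q"
    and "C \<subseteq> ham_vertices m Q"
    and "subgroup X (BijGroup (ham_vertices m Q))"
    and "X \<subseteq> diag_top_group m Q"
    and "neighbour_transitive m Q X C"
  shows "(\<exists>a \<in> Q. C = {const_word m a})
       \<or> C = Rep m Q
       \<or> (m < q \<and> C = Inj m Q)
       \<or> (q = 2 \<and> m \<ge> 3 \<and> odd m \<and> (\<forall>b \<in> Q. C = W_half m Q b))
       \<or> (\<exists>p::nat. p > 0 \<and> m = p * q \<and> C \<subseteq> All_code p Q)"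
proof -
  have C0: "C \<noteq> {}"
  proof -
    obtain x y where "x \<in> ham_vertices m Q" "C = {g x | g. g \<in> X}"
      "y \<in> ham_vertices m Q" "neighbour_set m Q C = {g y | g. g \<in> X}"
      using neighbour_transitive_orbitsD[OF assms(8)] .
    then show ?thesis using Bij_subgroup_one_mem[OF assms(6)] by auto
  qed
  have q: "card Q \<ge> 2" using assms(2,4) by simp
  obtain D where U: "uniform_moves m Q C D"
    using neighbour_transitive_uniform_moves[OF assms(1,3) q assms(5,7,8) C0] by blast
  have V: "\<alpha> \<in> ham_vertices m Q" if "\<alpha> \<in> C" for \<alpha> using that assms(5) by auto
  note shape = uniform_moves_shape[OF assms(1,3) q V _ U]
  have balanced: "m = p * q" if "\<alpha> \<in> C" "\<forall>a\<in>Q. letter_count m a \<alpha> = p" for \<alpha> p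
    using sum_letter_count[OF assms(3) V[OF that(1)]] that(2) assms(4) by (simp add: mult.commute)
  have missing: "m < q" if \<alpha>: "\<alpha> \<in> Inj m Q" and unused: "\<exists>b\<in>Q. letter_count m b \<alpha> = 0" for \<alpha>
  proof -
    obtain b where b: "b \<in> Q" "letter_count m b \<alpha> = 0" using unused by blast
    then have "b \<notin> \<alpha> ` {1..m}" using letter_count_pos_iff[of m b \<alpha>] by auto
    then have "\<alpha> ` {1..m} \<subset> Q" using \<alpha> b(1) by (auto simp: Inj_def ham_vertices_def)
    then have "card (\<alpha> ` {1..m}) < card Q" using assms(3) by (rule psubset_card_mono[rotated])
    then show ?thesis using \<alpha> assms(4) by (simp add: Inj_def card_image)
  qed
  obtain \<alpha> where \<alpha>: "\<alpha> \<in> C" using C0 by auto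
  \<comment> \<open>One codeword fixes \<open>D\<close>, which limits the shape of all others. Only
    \<open>D = 1\<close> leaves two shapes, told apart by comparing \<open>m\<close> with
    \<open>q\<close>.\<close>
  from shape[OF \<alpha> \<alpha>] consider
      (all) p where "D = 1" "p > 0" "\<forall>a\<in>Q. letter_count m a \<alpha> = p"
    | (rep) "D < 0"
    | (inj) "D = 1" "\<alpha> \<in> Inj m Q" "\<exists>b\<in>Q. letter_count m b \<alpha> = 0"
    | (half) k a b where "D = 2" "k > 0" "Q = {a, b}" "a \<noteq> b"
        "letter_count m a \<alpha> = Suc k" "letter_count m b \<alpha> = k"
    by blast
  then show ?thesis
  proof cases
    case all
    have m: "m = p * q" using balanced[OF \<alpha> all(3)] .
    then have "\<not> m < q" using all(2) by simp
    have "\<beta> \<in> All_code p Q" if \<beta>: "\<beta> \<in> C" for \<beta>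
    proof -
      have "(\<exists>r>0. \<forall>a\<in>Q. letter_count m a \<beta> = r)
          \<or> (\<beta> \<in> Inj m Q \<and> (\<exists>b\<in>Q. letter_count m b \<beta> = 0))"
        using shape[OF \<beta> \<beta>] unfolding all(1) by simp
      then obtain r where r: "\<forall>a\<in>Q. letter_count m a \<beta> = r"
        using missing \<open>\<not> m < q\<close> by blast
      have "r = p" using balanced[OF \<beta> r] m assms(2) by simp
      then show ?thesis using r V[OF \<beta>] m assms(4) by (simp add: All_code_def)
    qed
    then show ?thesis using m all(2) by blast
  next
    case rep
    have "C \<subseteq> Rep m Q"
    proof
      fix \<beta> assume \<beta>: "\<beta> \<in> C"
      have "D \<noteq> 1" "D \<noteq> 2" using rep by auto
      then show "\<beta> \<in> Rep m Q" using shape[OF \<beta> \<beta>] by (auto simp: Rep_def)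
    qed
    \<comment> \<open>All constant words have the same weight, so the group itself must decide which
      of them occur.\<close>
    then show ?thesis
      using neighbour_transitive_subset_Rep[OF assms(1,6,7,8) _ C0] by blast
  next
    case inj
    have m: "m < q" using missing[OF inj(2,3)] .
    have "\<beta> \<in> Inj m Q" if \<beta>: "\<beta> \<in> C" for \<beta>
    proof -
      have "(\<exists>r>0. \<forall>a\<in>Q. letter_count m a \<beta> = r) \<or> \<beta> \<in> Inj m Q"
        using shape[OF \<beta> \<beta>] unfolding inj(1) by auto
      \<comment> \<open>A codeword with equal positive counts would force
        \<open>m \<ge> q\<close>.\<close>
      moreover have "m \<noteq> r * q" if "r > 0" for r
        using m that by (cases r) auto
      ultimately show ?thesis using balanced[OF \<beta>] by blast
    qed
    then have "C \<subseteq> Inj m Q" by blast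
    then show ?thesis using Inj_closed_under_moves[OF _ assms(3) _ C0 U] m assms(4) by auto
  next
    case half
    have m: "m = 2 * k + 1" using letter_count_two_letters[OF half(3,4) V[OF \<alpha>]] half by simp
    have Q2: "card Q = 2" using half by simp
    have "C = W_half m Q b'" if b': "b' \<in> Q" for b'
    proof (rule W_half_closed_under_moves[OF Q2 b' m _ C0 U], rule subsetI)
      fix \<beta> assume \<beta>: "\<beta> \<in> C"
      obtain a' where a': "a' \<in> Q" "a' \<noteq> b'" using Q2 b' by (metis card_2_iff')
      obtain l c d where "Q = {c, d}" "c \<noteq> d" "letter_count m c \<beta> = Suc l" "letter_count m d \<beta> = l"
        using shape[OF \<beta> \<beta>] unfolding half(1) by auto
      then show "\<beta> \<in> W_half m Q b'"
        using W_half_iff[OF Q2 a'(1) b' a'(2) m] V[OF \<beta>] a' b' by auto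
    qed
    then show ?thesis using m half(2) Q2 assms(4) by auto
  qed
qed

end
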